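(* Let $\mathcal{A}=(a_{i_1i_2\ldots i_m})\in\mathbb{R}_{m,n}$ be a real tensor of order $m$ and dimension $n$. (a) If $\mathcal{A}$ is an almost semi-positive tensor (almost $\mathbf{E_0}$-tensor), then $a_{ii\ldots i}\ge 0$ for all $i\in I_n$. (b) If $\mathcal{A}$ is an almost strictly semi-positive tensor (almost $\mathbf{E}$-tensor), then $a_{ii\ldots i}>0$ for all $i\in I_n$. (c) If $\mathcal{A}$ is an almost $\mathbf{E_0}$-tensor, then there is $k\in I_n$ such that $$a_{kk\ldots k}+\sum_{\substack{(i_2,\ldots,i_m)\ne(k,\ldots,k)\\ a_{ki_2\ldots i_m}<0}}a_{ki_2\ldots i_m}<0.$$ (d) If $\mathcal{A}$ is an almost $\mathbf{E}$-tensor, then there is $k\in I_n$ such that $$a_{kk\ldots k}+\sum_{\substack{(i_2,\ldots,i_m)\ne(k,\ldots,k)\\ a_{ki_2\ldots i_m}<0}}a_{ki_2\ldots i_m}\le 0.$$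
   Context: $I_n=\{1,\ldots,n\}$, and $\mathbb{R}_{m,n}$ is the set of real tensors of order $m$ and dimension $n$, i.e. arrays $\mathcal{A}=(a_{i_1\ldots i_m})$ with $a_{i_1\ldots i_m}\in\mathbb{R}$ and $i_1,\ldots,i_m\in I_n$. For $\mathbf{x}\in\mathbb{R}^n$, the vector $\mathcal{A}\mathbf{x}^{m-1}\in\mathbb{R}^n$ is defined by $(\mathcal{A}\mathbf{x}^{m-1})_i=\sum_{i_2,\ldots,i_m=1}^n a_{i i_2\ldots i_m}x_{i_2}\cdots x_{i_m}$ for $i\in I_n$. Vector inequalities are componentwise. For $J\subseteq I_n$ with $|J|=r$, $1\le r\le n$, the principal subtensor of $\mathcal{A}$ indexed by $J$ is the tensor of order $m$ and dimension $r$ with entries $a_{i_1\ldots i_m}$, $i_1,\ldots,i_m\in J$; it is proper if $J\neq I_n$. $\mathcal{A}$ is semi-positive ($\mathbf{E_0}$-tensor), respectively strictly semi-positive ($\mathbf{E}$-tensor), if for each $\mathbf{x}\ge\mathbf{0}$, $\mathbf{x}\ne\mathbf{0}$, there is $k\in I_n$ with $x_k>0$ and $(\mathcal{A}\mathbf{x}^{m-1})_k\ge 0$, respectively $(\mathcal{A}\mathbf{x}^{m-1})_k>0$. $\mathcal{A}$ is almost semi-positive (almost $\mathbf{E_0}$-tensor) if every proper principal subtensor of $\mathcal{A}$ is semi-positive and there is a real vector $\mathbf{x}>\mathbf{0}$ with $\mathcal{A}\mathbf{x}^{m-1}<\mathbf{0}$. $\mathcal{A}$ is almost strictly semi-positive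 (almost $\mathbf{E}$-tensor) if every proper principal subtensor of $\mathcal{A}$ is strictly semi-positive and there is a real vector $\mathbf{x}>\mathbf{0}$ with $\mathcal{A}\mathbf{x}^{m-1}\le\mathbf{0}$.
   Formalization: Parts (a) and (b) are proved for dimension n ≥ 2; for n = 1 there is no proper principal subtensor, so the tensor with single entry −1 is both almost semi-positive and almost strictly semi-positive, yet its diagonal entry is negative. *)

theory Defs
  imports Complex_Main "HOL-Library.NList"
begin

text \<open>A real tensor of order \<open>m\<close> and dimension \<open>n\<close> maps an index tuple, i.e. a list of length \<open>m\<close>
  over \<open>I n\<close>, to its entry. Vectors in \<open>\<real>\<^sup>n\<close> are functions restricted to \<open>I n\<close>. The order and the
  dimension are explicit parameters, and values of tensors and vectors outside the index range are
  never inspected. Explicit dimensions are needed because principal subtensors change them.\<close>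

type_synonym tensor = "nat list \<Rightarrow> real"

abbreviation I :: "nat \<Rightarrow> nat set" where
  "I n \<equiv> {1..n}"

definition tensor_apply :: "nat \<Rightarrow> nat \<Rightarrow> tensor \<Rightarrow> (nat \<Rightarrow> real) \<Rightarrow> nat \<Rightarrow> real" where
  "tensor_apply m n A x i =
     (\<Sum>js \<in> nlists (m - 1) (I n). A (i # js) * prod_list (map x js))"

text \<open>The index set \<open>J\<close> is relabelled increasingly by \<open>1, \<dots>, card J\<close>, so that the principal
  subtensor is again a tensor over an initial segment, of dimension \<open>card J\<close>.\<close>

definition principal_subtensor :: "nat set \<Rightarrow> tensor \<Rightarrow> tensor" where
  "principal_subtensor J A = (\<lambda>js. A (map (\<lambda>j. sorted_list_of_set J ! (j - 1)) js))"

definition semi_positive :: "nat \<Rightarrow> nat \<Rightarrow> tensor \<Rightarrow> bool" where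
  "semi_positive m n A \<longleftrightarrow>
     (\<forall>x. (\<forall>i \<in> I n. x i \<ge> 0) \<and> (\<exists>i \<in> I n. x i \<noteq> 0) \<longrightarrow>
       (\<exists>k \<in> I n. x k > 0 \<and> tensor_apply m n A x k \<ge> 0))"

definition strictly_semi_positive :: "nat \<Rightarrow> nat \<Rightarrow> tensor \<Rightarrow> bool" where
  "strictly_semi_positive m n A \<longleftrightarrow>
     (\<forall>x. (\<forall>i \<in> I n. x i \<ge> 0) \<and> (\<exists>i \<in> I n. x i \<noteq> 0) \<longrightarrow>
       (\<exists>k \<in> I n. x k > 0 \<and> tensor_apply m n A x k > 0))"

definition almost_semi_positive :: "nat \<Rightarrow> nat \<Rightarrow> tensor \<Rightarrow> bool" where
  "almost_semi_positive m n A \<longleftrightarrow>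
     (\<forall>J. J \<noteq> {} \<and> J \<subset> I n \<longrightarrow> semi_positive m (card J) (principal_subtensor J A)) \<and>
     (\<exists>x. (\<forall>i \<in> I n. x i > 0) \<and> (\<forall>i \<in> I n. tensor_apply m n A x i < 0))"

definition almost_strictly_semi_positive :: "nat \<Rightarrow> nat \<Rightarrow> tensor \<Rightarrow> bool" where
  "almost_strictly_semi_positive m n A \<longleftrightarrow>
     (\<forall>J. J \<noteq> {} \<and> J \<subset> I n \<longrightarrow> strictly_semi_positive m (card J) (principal_subtensor J A)) \<and>
     (\<exists>x. (\<forall>i \<in> I n. x i > 0) \<and> (\<forall>i \<in> I n. tensor_apply m n A x i \<le> 0))"

end

theory Submission imports Defs begin

text \<open>The diagonal entry \<open>a\<^sub>i\<^sub>\<dots>\<^sub>i\<close> is the only entry of the principal subtensor indexed by \<open>{i}\<close>,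
  which is proper as soon as the dimension is at least two; evaluating that one-dimensional
  subtensor at the vector \<open>1\<close> shows that it inherits the sign required by (strict)
  semi-positivity (lemmas \<open>singleton_semi_positive\<close> and \<open>singleton_strictly_semi_positive\<close>).

  For the row sums, take a positive vector \<open>x\<close> at which the tensor is negative (nonpositive) in every
  coordinate, and let \<open>x\<^sub>k\<close> be its largest coordinate. Each monomial in coordinates of \<open>x\<close> of degree
  \<open>m - 1\<close> lies between \<open>0\<close> and the \<open>(m - 1)\<close>-st power of \<open>x\<^sub>k\<close>. Thus discarding the nonnegative
  off-diagonal terms of coordinate \<open>k\<close>, and replacing the monomials of the negative ones by that
  power, can only decrease the value. What remains is the power, which is positive, times the row
  sum of the theorem (lemma \<open>row_sum_le_tensor_apply\<close>); so the row sum has the required sign.\<close>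

lemma finite_nlists:
  assumes "finite S"
  shows "finite (nlists r S)"
proof -
  have "nlists r S = {xs. set xs \<subseteq> S \<and> length xs = r}"
    unfolding nlists_def by blast
  then show ?thesis using finite_lists_length_eq[OF assms, of r] by (simp only:)
qed

lemma tensor_apply_principal_subtensor_singleton:
  assumes "m \<ge> 1"
  shows "tensor_apply m 1 (principal_subtensor {i} A) x 1 = A (replicate m i) * x 1 ^ (m - 1)"
proof -
  have "replicate m i = i # replicate (m - 1) i"
    using assms by (cases m) auto
  then show ?thesis
    by (simp add: tensor_apply_def principal_subtensor_def nlists_singleton)
qed

lemma singleton_semi_positive:
  assumes "m \<ge> 1" and "semi_positive m 1 (principal_subtensor {i} A)"
  shows "A (replicate m i) \<ge> 0"
  using assms(2)[unfolded semi_positive_def, rule_format, of "\<lambda>_. 1"]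
    tensor_apply_principal_subtensor_singleton[OF assms(1), of i A "\<lambda>_. 1"]
  by auto

lemma singleton_strictly_semi_positive:
  assumes "m \<ge> 1" and "strictly_semi_positive m 1 (principal_subtensor {i} A)"
  shows "A (replicate m i) > 0"
  using assms(2)[unfolded strictly_semi_positive_def, rule_format, of "\<lambda>_. 1"]
    tensor_apply_principal_subtensor_singleton[OF assms(1), of i A "\<lambda>_. 1"]
  by auto

lemma singleton_proper_subset:
  assumes "n \<ge> 2" and "i \<in> I n"
  shows "{i} \<subset> I n"
proof -
  have "1 \<in> I n" and "2 \<in> I n" using assms(1) by auto
  then have "I n \<noteq> {i}" by force
  then show ?thesis using assms(2) by blast
qed

lemma prod_list_map_bounds:
  fixes x :: "'a \<Rightarrow> real"
  assumes "\<And>j. j \<in> set js \<Longrightarrow> 0 \<le> x j \<and> x j \<le> c"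
  shows "0 \<le> prod_list (map x js) \<and> prod_list (map x js) \<le> c ^ length js"
  using assms
proof (induction js)
  case (Cons j js)
  then have "0 \<le> x j" "x j \<le> c"
    and "0 \<le> prod_list (map x js)" "prod_list (map x js) \<le> c ^ length js"
    by simp_all
  then show ?case using mult_mono[of "x j" c "prod_list (map x js)" "c ^ length js"] by simp
qed simp

text \<open>If \<open>x\<^sub>k\<close> is a largest coordinate of the nonnegative vector \<open>x\<close>, then coordinate \<open>k\<close> of the value
  of the tensor at \<open>x\<close> dominates the diagonal entry plus the negative off-diagonal entries of row \<open>k\<close>,
  scaled by a power of \<open>x\<^sub>k\<close>.\<close>

lemma row_sum_le_tensor_apply:
  assumes m: "m \<ge> 1" and k: "k \<in> I n"
    and x: "\<And>j. j \<in> I n \<Longrightarrow> 0 \<le> x j \<and> x j \<le> x k"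
  shows "x k ^ (m - 1) * (A (replicate m k)
      + (\<Sum>js | js \<in> nlists (m - 1) (I n) \<and> js \<noteq> replicate (m - 1) k \<and> A (k # js) < 0.
           A (k # js))) \<le> tensor_apply m n A x k"
proof -
  define L where "L = nlists (m - 1) (I n)"
  define d where "d = replicate (m - 1) k"
  define N where "N = {js \<in> L. js \<noteq> d \<and> A (k # js) < 0}"
  let ?p = "\<lambda>js. prod_list (map x js)"
  have fin: "finite L"
    unfolding L_def by (rule finite_nlists) simp
  have d: "d \<in> L"
    using k unfolding L_def d_def by (rule nlists_replicateI)
  have diag: "replicate m k = k # d"
    using m by (cases m) (auto simp: d_def)
  have p: "0 \<le> ?p js \<and> ?p js \<le> x k ^ (m - 1)" if "js \<in> L" for js
    using prod_list_map_bounds[of js x "x k"] x nlistsE_set[OF that[unfolded L_def]]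
    unfolding nlistsE_length[OF that[unfolded L_def]] by blast
  \<comment> \<open>First the monomials of the negative entries are bounded, then the nonnegative terms added.\<close>
  have "x k ^ (m - 1) * (\<Sum>js\<in>N. A (k # js)) = (\<Sum>js\<in>N. A (k # js) * x k ^ (m - 1))"
    by (simp only: sum_distrib_left mult.commute[of "x k ^ (m - 1)"])
  also have "\<dots> \<le> (\<Sum>js\<in>N. A (k # js) * ?p js)"
    by (rule sum_mono) (use p in \<open>auto simp: N_def intro: mult_left_mono_neg\<close>)
  also have "\<dots> \<le> (\<Sum>js\<in>L - {d}. A (k # js) * ?p js)"
    by (rule sum_mono2) (use fin p in \<open>auto simp: N_def not_less\<close>)
  finally have off: "x k ^ (m - 1) * (\<Sum>js\<in>N. A (k # js)) \<le> \<dots>" .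
  have "tensor_apply m n A x k = A (k # d) * ?p d + (\<Sum>js\<in>L - {d}. A (k # js) * ?p js)"
    using sum.remove[OF fin d] by (simp add: tensor_apply_def L_def)
  also have "?p d = x k ^ (m - 1)"
    by (simp add: d_def)
  finally have "x k ^ (m - 1) * (A (k # d) + (\<Sum>js\<in>N. A (k # js))) \<le> tensor_apply m n A x k"
    using off unfolding distrib_left mult.commute[of "A (k # d)"] by linarith
  then show ?thesis
    unfolding N_def L_def d_def diag .
qed

text \<open>At a positive vector, some coordinate of the value of the tensor dominates a positive multiple
  of the row sum, namely the coordinate at which the vector is largest.\<close>

lemma exists_row_sum_le_tensor_apply:
  assumes m: "m \<ge> 1" and n: "n \<ge> 1" and x: "\<And>i. i \<in> I n \<Longrightarrow> x i > 0"
  obtains k c where "k \<in> I n" and "c > 0"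
    and "c * (A (replicate m k)
      + (\<Sum>js | js \<in> nlists (m - 1) (I n) \<and> js \<noteq> replicate (m - 1) k \<and> A (k # js) < 0.
           A (k # js))) \<le> tensor_apply m n A x k"
proof -
  have "Max (x ` I n) \<in> x ` I n"
    using n by (intro Max_in) auto
  then obtain k where k: "k \<in> I n" "x k = Max (x ` I n)"
    by auto
  have "0 \<le> x j \<and> x j \<le> x k" if "j \<in> I n" for j
    using that x[OF that] by (simp add: k(2) less_imp_le)
  then show thesis
    by (rule that[OF k(1) zero_less_power[OF x[OF k(1)]] row_sum_le_tensor_apply[OF m k(1)]])
qed

lemma almost_semi_positive_diagonal:
  assumes "m \<ge> 1" and "n \<ge> 2" and "almost_semi_positive m n A" and "i \<in> I n"
  shows "A (replicate m i) \<ge> 0"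
proof -
  have "semi_positive m (card {i}) (principal_subtensor {i} A)"
    using assms(3) singleton_proper_subset[OF assms(2,4)]
    unfolding almost_semi_positive_def by blast
  then show ?thesis
    using singleton_semi_positive[OF assms(1)] by simp
qed

lemma almost_strictly_semi_positive_diagonal:
  assumes "m \<ge> 1" and "n \<ge> 2" and "almost_strictly_semi_positive m n A" and "i \<in> I n"
  shows "A (replicate m i) > 0"
proof -
  have "strictly_semi_positive m (card {i}) (principal_subtensor {i} A)"
    using assms(3) singleton_proper_subset[OF assms(2,4)]
    unfolding almost_strictly_semi_positive_def by blast
  then show ?thesis
    using singleton_strictly_semi_positive[OF assms(1)] by simp
qed

lemma almost_semi_positive_row_sum:
  assumes "m \<ge> 1" and "n \<ge> 1" and "almost_semi_positive m n A"
  shows "\<exists>k \<in> I n. A (replicate m k)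
      + (\<Sum>js | js \<in> nlists (m - 1) (I n) \<and> js \<noteq> replicate (m - 1) k \<and> A (k # js) < 0.
           A (k # js)) < 0"
proof -
  obtain x where x: "\<And>i. i \<in> I n \<Longrightarrow> x i > 0"
    and neg: "\<And>i. i \<in> I n \<Longrightarrow> tensor_apply m n A x i < 0"
    using assms(3) unfolding almost_semi_positive_def by blast
  obtain k c where k: "k \<in> I n" and c: "c > 0"
    and le: "c * (A (replicate m k)
      + (\<Sum>js | js \<in> nlists (m - 1) (I n) \<and> js \<noteq> replicate (m - 1) k \<and> A (k # js) < 0.
           A (k # js))) \<le> tensor_apply m n A x k"
    by (rule exists_row_sum_le_tensor_apply[OF assms(1,2) x])
  show ?thesis
    using order.strict_trans1[OF le neg[OF k]] c k
    unfolding mult_less_0_iff by (intro bexI[OF _ k]) linarith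
qed

lemma almost_strictly_semi_positive_row_sum:
  assumes "m \<ge> 1" and "n \<ge> 1" and "almost_strictly_semi_positive m n A"
  shows "\<exists>k \<in> I n. A (replicate m k)
      + (\<Sum>js | js \<in> nlists (m - 1) (I n) \<and> js \<noteq> replicate (m - 1) k \<and> A (k # js) < 0.
           A (k # js)) \<le> 0"
proof -
  obtain x where x: "\<And>i. i \<in> I n \<Longrightarrow> x i > 0"
    and neg: "\<And>i. i \<in> I n \<Longrightarrow> tensor_apply m n A x i \<le> 0"
    using assms(3) unfolding almost_strictly_semi_positive_def by blast
  obtain k c where k: "k \<in> I n" and c: "c > 0"
    and le: "c * (A (replicate m k)
      + (\<Sum>js | js \<in> nlists (m - 1) (I n) \<and> js \<noteq> replicate (m - 1) k \<and> A (k # js) < 0.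
           A (k # js))) \<le> tensor_apply m n A x k"
    by (rule exists_row_sum_le_tensor_apply[OF assms(1,2) x])
  show ?thesis
    using order.trans[OF le neg[OF k]] c k
    unfolding mult_le_0_iff by (intro bexI[OF _ k]) linarith
qed

theorem proposition4p1:
  fixes m n :: nat and A :: tensor
  assumes "m \<ge> 1" and "n \<ge> 1"
  shows "(n \<ge> 2 \<longrightarrow> almost_semi_positive m n A \<longrightarrow>
            (\<forall>i \<in> I n. A (replicate m i) \<ge> 0)) \<and>
         (n \<ge> 2 \<longrightarrow> almost_strictly_semi_positive m n A \<longrightarrow>
            (\<forall>i \<in> I n. A (replicate m i) > 0)) \<and>
         (almost_semi_positive m n A \<longrightarrow>
            (\<exists>k \<in> I n. A (replicate m k)
               + (\<Sum>js | js \<in> nlists (m - 1) (I n) \<and> js \<noteq> replicate (m - 1) k \<and> A (k # js) < 0.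
                    A (k # js)) < 0)) \<and>
         (almost_strictly_semi_positive m n A \<longrightarrow>
            (\<exists>k \<in> I n. A (replicate m k)
               + (\<Sum>js | js \<in> nlists (m - 1) (I n) \<and> js \<noteq> replicate (m - 1) k \<and> A (k # js) < 0.
                    A (k # js)) \<le> 0))"
  using almost_semi_positive_diagonal[OF assms(1)] almost_strictly_semi_positive_diagonal[OF assms(1)]
    almost_semi_positive_row_sum[OF assms] almost_strictly_semi_positive_row_sum[OF assms]
  by (intro conjI impI ballI)

end
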